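(* Let $P_1, P_2$ be two isogonal conjugated points with respect to a triangle $ABC$, and let $A_1B_1C_1$ and $A_2B_2C_2$ be the pedal triangles of $P_1$ and $P_2$, respectively, with respect to $ABC$. If the triangles $ABC$ and $A_1B_1C_1$ are homological, then the triangles $ABC$ and $A_2B_2C_2$ are also homological.
   Context: Isogonal Cevians: in a triangle $ABC$, two Cevians from the vertex $A$ (lines through $A$ meeting the line $BC$) are called isogonal if they are symmetric with respect to the bisector of the angle $BAC$; likewise for the Cevians from $B$ and from $C$ and the bisectors of the angles at those vertices. Isogonal conjugated points (isogonal points): the intersection point $P_1$ of three concurrent Cevians of the triangle $ABC$ (one from each vertex) and the intersection point $P_2$ of their isogonal Cevians are called isogonal conjugated points. The points are not required to lie in the interior of the triangle. Pedal triangle: for a point $P$ in the plane of the triangle $ABC$ which is not on the circumscribed circle of $ABC$, the pedal triangle of $P$ is the triangle $A'B'C'$, where $A', B', C'$ are the orthogonal projections of $P$ on $BC$, $AC$, $AB$, respectively. Thus $A_i, B_i, C_i$ are the orthogonal projections of $P_i$ on $BC$, $CA$, $AB$, respectively, for $i=1,2$. Homological triangles: two triangles $ABC$ and $A'B'C'$ (with vertices corresponding in this order) are called homological if the lines $AA'$, $BB'$, $CC'$ are concurrent.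
   Formalization: "Concurrent" in the definition of homological triangles is read as having a common point or being all three parallel (a common point at infinity), since with ordinary concurrency the claim fails, e.g. A=(0,2), B=(-1,0), C=(1,0), P1=(0,-1/4), P2=(0,9/2). *)

theory Defs
  imports "HOL-Analysis.Analysis"
begin

type_synonym point = "real ^ 2"

definition line :: "point \<Rightarrow> point \<Rightarrow> point set" where
  "line X Y = affine hull {X, Y}"

definition proper_triangle :: "point \<Rightarrow> point \<Rightarrow> point \<Rightarrow> bool" where
  "proper_triangle A B C \<longleftrightarrow> \<not> collinear {A, B, C}"

definition circumcircle :: "point \<Rightarrow> point \<Rightarrow> point \<Rightarrow> point set" where
  "circumcircle A B C = {X. \<exists>Q. dist Q A = dist Q B \<and> dist Q A = dist Q C \<and> dist Q A = dist Q X}"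

definition orth_projection :: "point \<Rightarrow> point set \<Rightarrow> point \<Rightarrow> bool" where
  "orth_projection P l H \<longleftrightarrow> H \<in> l \<and> (\<forall>X\<in>l. \<forall>Y\<in>l. orthogonal (P - H) (Y - X))"

definition mirror_line :: "point set \<Rightarrow> point set \<Rightarrow> point set" where
  "mirror_line d l = {Y. \<exists>X\<in>l. orth_projection X d (midpoint X Y)}"

(* The internal bisector of the angle BAC, as a full line: on vectors, sgn is
   normalisation, and the sum of the two unit vectors along the sides bisects the angle. *)
definition angle_bisector :: "point \<Rightarrow> point \<Rightarrow> point \<Rightarrow> point set" where
  "angle_bisector B A C = line A (A + sgn (B - A) + sgn (C - A))"

definition cevian :: "point \<Rightarrow> point \<Rightarrow> point \<Rightarrow> point set \<Rightarrow> bool" where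
  "cevian A B C l \<longleftrightarrow> (\<exists>X. X \<noteq> A \<and> l = line A X) \<and> l \<inter> line B C \<noteq> {}"

definition isogonal_cevians ::
    "point \<Rightarrow> point \<Rightarrow> point \<Rightarrow> point set \<Rightarrow> point set \<Rightarrow> bool" where
  "isogonal_cevians A B C l m \<longleftrightarrow>
     cevian A B C l \<and> cevian A B C m \<and> m = mirror_line (angle_bisector B A C) l"

definition isogonal_points ::
    "point \<Rightarrow> point \<Rightarrow> point \<Rightarrow> point \<Rightarrow> point \<Rightarrow> bool" where
  "isogonal_points A B C P1 P2 \<longleftrightarrow>
     (\<exists>lA lB lC mA mB mC.
        isogonal_cevians A B C lA mA \<and>
        isogonal_cevians B C A lB mB \<and>
        isogonal_cevians C A B lC mC \<and>
        lA \<inter> lB \<inter> lC = {P1} \<and> mA \<inter> mB \<inter> mC = {P2})"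

definition pedal_triangle ::
    "point \<Rightarrow> point \<Rightarrow> point \<Rightarrow> point \<Rightarrow> point \<Rightarrow> point \<Rightarrow> point \<Rightarrow> bool" where
  "pedal_triangle A B C P A' B' C' \<longleftrightarrow>
     P \<notin> circumcircle A B C \<and>
     orth_projection P (line B C) A' \<and>
     orth_projection P (line C A) B' \<and>
     orth_projection P (line A B) C'"

(* Concurrency in the plane completed by its points at infinity: three lines meet in a
   point at infinity exactly when they are parallel.  The isogonal conjugate of a point with
   a finite homology centre can have its homology centre at infinity: for A = (0,2),
   B = (-1,0), C = (1,0), P1 = (0,-1/4), P2 = (0,9/2) the lines AA1, BB1, CC1 meet in a
   point of the plane, whereas AA2, BB2, CC2 are three distinct parallels. *)
definition concurrent :: "point set \<Rightarrow> point set \<Rightarrow> point set \<Rightarrow> bool" where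
  "concurrent l m n \<longleftrightarrow>
     (\<exists>Q. Q \<in> l \<and> Q \<in> m \<and> Q \<in> n) \<or> (affine_parallel l m \<and> affine_parallel m n)"

definition homological ::
    "point \<Rightarrow> point \<Rightarrow> point \<Rightarrow> point \<Rightarrow> point \<Rightarrow> point \<Rightarrow> bool" where
  "homological A B C A' B' C' \<longleftrightarrow>
     A \<noteq> A' \<and> B \<noteq> B' \<and> C \<noteq> C' \<and>
     concurrent (line A A') (line B B') (line C C')"

end

theory Submission
  imports Defs
begin

text \<open>
  Let the feet of a point divide the sides as \<open>A' = B + t (C - B)\<close>, \<open>B' = C + u (A - C)\<close>,
  \<open>C' = A + v (B - A)\<close>.  By Ceva's theorem the triangles are homological exactly when
  \<open>t u v = (1 - t) (1 - u) (1 - v)\<close>; as concurrency admits a common point at infinity, this is an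
  equivalence without exceptions (\<open>ceva_iff_concurrent\<close>).

  Isogonal lines through a vertex are exchanged by the reflection that exchanges the two sides
  there, so for isogonal conjugates the product of the two signed distances from the vertex to the
  feet is the same on both sides (\<open>isogonal_feet_products\<close>).  This is the power of the vertex with
  respect to the common pedal circle of the two points.
  Multiplying the three equalities cancels the side lengths and gives
  \<open>(t1 u1 v1) (t2 u2 v2) = ((1 - t1) (1 - u1) (1 - v1)) ((1 - t2) (1 - u2) (1 - v2))\<close>.
  The first factors on the two sides agree by hypothesis, and cancelling them leaves Ceva's equation
  for the second point.

  Cancelling requires the common value to be nonzero.  It vanishes only if two of the feet
  are vertices in such a way that the point is a vertex or the antipode of a vertex on the
  circumcircle (\<open>ceva_product_nonzero\<close>); the first point is off that circle because it has a pedal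
  triangle.
\<close>

section \<open>Lines and independence of the sides\<close>

lemma mem_line_iff: "Z \<in> line X Y \<longleftrightarrow> (\<exists>k. Z = X + k *\<^sub>R (Y - X))"
  by (auto simp: line_def affine_hull_2_alt)

lemma endpoints_in_line: "X \<in> line X Y" "Y \<in> line X Y"
  by (auto simp: line_def hull_inc)

lemma parallel_lines_imp_scaled_direction:
  assumes "affine_parallel (line X Y) (line Z W)"
  shows "\<exists>m. W - Z = m *\<^sub>R (Y - X)"
proof -
  obtain a where a: "line Z W = (\<lambda>x. a + x) ` line X Y"
    using assms by (auto simp: affine_parallel_def)
  have "Z \<in> (\<lambda>x. a + x) ` line X Y" "W \<in> (\<lambda>x. a + x) ` line X Y"
    unfolding a[symmetric] by (rule endpoints_in_line)+
  then obtain i j where "Z = a + (X + i *\<^sub>R (Y - X))" "W = a + (X + j *\<^sub>R (Y - X))"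
    unfolding image_iff Bex_def mem_line_iff by blast
  then have "W - Z = (j - i) *\<^sub>R (Y - X)"
    by (simp add: scaleR_diff_left)
  then show ?thesis ..
qed

lemma scaled_direction_imp_parallel_lines:
  assumes "W - Z = m *\<^sub>R (Y - X)" and "m \<noteq> 0"
  shows "affine_parallel (line X Y) (line Z W)"
proof -
  have "line Z W = (\<lambda>x. (Z - X) + x) ` line X Y"
  proof (intro set_eqI iffI)
    fix P assume "P \<in> line Z W"
    then obtain k where "P = Z + k *\<^sub>R (W - Z)"
      by (auto simp: mem_line_iff)
    then have "P = (Z - X) + (X + (k * m) *\<^sub>R (Y - X))"
      using assms(1) by simp
    then show "P \<in> (\<lambda>x. (Z - X) + x) ` line X Y"
      by (metis mem_line_iff rev_image_eqI)
  next
    fix P assume "P \<in> (\<lambda>x. (Z - X) + x) ` line X Y"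
    then obtain k where "P = (Z - X) + (X + k *\<^sub>R (Y - X))"
      unfolding image_iff Bex_def mem_line_iff by blast
    then have "P = Z + (k / m) *\<^sub>R (W - Z)"
      using assms by simp
    then show "P \<in> line Z W"
      by (auto simp: mem_line_iff)
  qed
  then show ?thesis
    by (auto simp: affine_parallel_def)
qed

lemma proper_triangle_rotate: "proper_triangle A B C \<longleftrightarrow> proper_triangle B C A"
  by (simp add: proper_triangle_def insert_commute)

lemma proper_triangle_sides_not_collinear:
  assumes "proper_triangle A B C"
  shows "\<not> collinear {0, B - A, C - A}"
  using assms collinear_3[of B A C]
  by (simp add: proper_triangle_def insert_commute)

lemma proper_triangle_independent:
  assumes "proper_triangle A B C" and "x *\<^sub>R (B - A) + y *\<^sub>R (C - A) = 0"
  shows "x = 0 \<and> y = 0"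
proof -
  have nc: "B - A \<noteq> 0" "C - A \<noteq> 0" "\<And>k. C - A \<noteq> k *\<^sub>R (B - A)"
    using proper_triangle_sides_not_collinear[OF assms(1)] by (auto simp: collinear_lemma)
  have "y = 0"
  proof (rule ccontr)
    assume "y \<noteq> 0"
    have "C - A = (1 / y) *\<^sub>R (y *\<^sub>R (C - A))"
      using \<open>y \<noteq> 0\<close> by simp
    also have "y *\<^sub>R (C - A) = - (x *\<^sub>R (B - A))"
      using assms(2) by (simp add: eq_neg_iff_add_eq_0 add.commute)
    finally have "C - A = (- (x / y)) *\<^sub>R (B - A)"
      by (simp only: scaleR_minus_right scaleR_minus_left scaleR_scaleR) simp
    then show False
      using nc(3) by blast
  qed
  then show ?thesis
    using assms(2) nc(1) by simp
qed

lemma proper_triangle_coordinates_unique: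
  assumes "proper_triangle A B C"
    and "A + x *\<^sub>R (B - A) + y *\<^sub>R (C - A) = A + x' *\<^sub>R (B - A) + y' *\<^sub>R (C - A)"
  shows "x = x'" and "y = y'"
proof -
  have "(x - x') *\<^sub>R (B - A) + (y - y') *\<^sub>R (C - A) = 0"
    using assms(2) by (simp add: scaleR_diff_left algebra_simps)
  from proper_triangle_independent[OF assms(1) this] show "x = x'" "y = y'"
    by auto
qed

section \<open>Ceva's theorem in the completed plane\<close>

text \<open>In the affine frame \<open>(A; B - A, C - A)\<close> the cevians have directions
  \<open>(1 - t, t)\<close>, \<open>(-1, 1 - u)\<close>, \<open>(v, -1)\<close>.  The difference of the two sides of the equation is, up to
  sign, the determinant of the three lines in homogeneous coordinates.  Its vanishing means a common
  projective point, which lies at infinity exactly when the lines are parallel.\<close>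

lemma ceva_iff_concurrent:
  assumes T: "proper_triangle A B C"
    and A': "A' = B + t *\<^sub>R (C - B)"
    and B': "B' = C + u *\<^sub>R (A - C)"
    and C': "C' = A + v *\<^sub>R (B - A)"
  shows "concurrent (line A A') (line B B') (line C C')
           \<longleftrightarrow> t * u * v = (1 - t) * (1 - u) * (1 - v)"
proof -
  define b c where "b = B - A" and "c = C - A"
  have BC: "B = A + b" "C = A + c"
    by (simp_all add: b_def c_def)
  have uniq: "x = x' \<and> y = y'"
    if "A + x *\<^sub>R b + y *\<^sub>R c = A + x' *\<^sub>R b + y' *\<^sub>R c" for x y x' y'
    using proper_triangle_coordinates_unique[OF T, of x y x' y'] that
    by (simp add: b_def c_def)
  have dA: "A' - A = (1 - t) *\<^sub>R b + t *\<^sub>R c"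
    by (simp add: A' BC algebra_simps)
  have dB: "B' - B = (- 1) *\<^sub>R b + (1 - u) *\<^sub>R c"
    by (simp add: B' BC algebra_simps)
  have dC: "C' - C = v *\<^sub>R b + (- 1) *\<^sub>R c"
    by (simp add: C' BC algebra_simps)
  have onA: "Q \<in> line A A' \<longleftrightarrow> (\<exists>p. Q = A + (p * (1 - t)) *\<^sub>R b + (p * t) *\<^sub>R c)" for Q
    by (simp add: mem_line_iff dA scaleR_add_right add.assoc)
  have onB: "Q \<in> line B B' \<longleftrightarrow> (\<exists>q. Q = A + (1 - q) *\<^sub>R b + (q * (1 - u)) *\<^sub>R c)" for Q
    by (simp add: mem_line_iff dB, simp add: BC algebra_simps)
  have onC: "Q \<in> line C C' \<longleftrightarrow> (\<exists>r. Q = A + (r * v) *\<^sub>R b + (1 - r) *\<^sub>R c)" for Q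
    by (simp add: mem_line_iff dC, simp add: BC algebra_simps)
  show ?thesis
  proof
    assume "concurrent (line A A') (line B B') (line C C')"
    then consider Q where "Q \<in> line A A'" "Q \<in> line B B'" "Q \<in> line C C'"
      | "affine_parallel (line A A') (line B B')" "affine_parallel (line B B') (line C C')"
      by (auto simp: concurrent_def)
    then show "t * u * v = (1 - t) * (1 - u) * (1 - v)"
    proof cases
      case 1
      then obtain p q r where
        Q: "Q = A + (p * (1 - t)) *\<^sub>R b + (p * t) *\<^sub>R c"
           "Q = A + (1 - q) *\<^sub>R b + (q * (1 - u)) *\<^sub>R c"
           "Q = A + (r * v) *\<^sub>R b + (1 - r) *\<^sub>R c"
        unfolding onA onB onC by blast
      have e: "p * (1 - t) = 1 - q" "p * t = q * (1 - u)" "p * (1 - t) = r * v" "p * t = 1 - r"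
        using uniq Q by metis+
      have qu: "q * u = 1 - p" and rv: "r * (1 - v) = 1 - p"
        using e by (simp_all add: algebra_simps)
      \<comment> \<open>The barycentric coordinates of the common point with respect to the triangle are
        \<open>1 - p\<close>, \<open>1 - q\<close>, \<open>1 - r\<close>; each is computed from two cevians, and both sides below are
        their product.\<close>
      have *: "p * q * r * (t * u * v) = p * q * r * ((1 - t) * (1 - u) * (1 - v))"
      proof -
        have "p * q * r * (t * u * v) = (p * t) * (q * u) * (r * v)" by simp
        also have "\<dots> = (q * (1 - u)) * (r * (1 - v)) * (p * (1 - t))"
          by (simp add: e(2) qu rv flip: e(3))
        finally show ?thesis by (simp add: mult_ac)
      qed
      show ?thesis
      proof (cases "p * q * r = 0")
        case False
        then show ?thesis using * by simp
      next
        case True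
        \<comment> \<open>The common point is then a vertex, and both products contain a zero factor.\<close>
        then consider "p = 0" | "q = 0" | "r = 0" by auto
        then show ?thesis
        proof cases
          case 1
          then have "q = 1" "r = 1" using e by auto
          then show ?thesis using qu e(3) 1 by simp
        next
          case 2
          then have "p = 1" "t = 0" "r = 1" using qu e by auto
          then show ?thesis using rv by simp
        next
          case 3
          then have "p = 1" "t = 1" "q = 1" using rv e by auto
          then show ?thesis using qu by simp
        qed
      qed
    next
      case 2
      obtain m where "B' - B = m *\<^sub>R (A' - A)"
        using parallel_lines_imp_scaled_direction[OF 2(1)] by blast
      then have "A + (- 1) *\<^sub>R b + (1 - u) *\<^sub>R c = A + (m * (1 - t)) *\<^sub>R b + (m * t) *\<^sub>R c"
        unfolding dA dB by (simp add: scaleR_add_right)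
      from uniq[OF this] have m: "- 1 = m * (1 - t)" "1 - u = m * t" by auto
      obtain n where "B' - B = n *\<^sub>R (C' - C)"
        using parallel_lines_imp_scaled_direction 2(2) affine_parallel_commute by blast
      then have "A + (- 1) *\<^sub>R b + (1 - u) *\<^sub>R c = A + (n * v) *\<^sub>R b + (- n) *\<^sub>R c"
        unfolding dB dC by (simp add: scaleR_diff_right)
      from uniq[OF this] have n: "- 1 = n * v" "1 - u = - n" by auto
      have "(1 - t) * (1 - u) = - t" "v * (1 - u) = 1"
        using m n by algebra+
      then show ?thesis
        by algebra
    qed
  next
    assume ceva: "t * u * v = (1 - t) * (1 - u) * (1 - v)"
    \<comment> \<open>The determinant of the directions of the cevians from \<open>A\<close> and \<open>B\<close>.\<close>
    define D where "D = (1 - t) * (1 - u) + t"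
    consider "D \<noteq> 0" | "D = 0" "t = 0" | "D = 0" "t \<noteq> 0" by blast
    then show "concurrent (line A A') (line B B') (line C C')"
    proof cases
      case 1
      \<comment> \<open>Cramer's rule for the intersection of the first two cevians; \<open>r\<close> is then
        forced by the coordinate along \<open>c\<close>.\<close>
      define p q r where "p = (1 - u) / D" and "q = t / D" and "r = 1 - t * (1 - u) / D"
      have 1: "p * (1 - t) = 1 - q" "p * t = q * (1 - u)" "p * t = 1 - r"
        using 1 by (simp_all add: p_def q_def r_def field_simps) (simp_all add: D_def algebra_simps)
      have "(1 - u) * (1 - t) = (D - t * (1 - u)) * v"
        using ceva unfolding D_def by algebra
      then have "p * (1 - t) = r * v"
        using \<open>D \<noteq> 0\<close> by (simp add: p_def r_def field_simps)
      with 1 show ?thesis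
        unfolding concurrent_def onA onB onC by metis
    next
      case 2
      \<comment> \<open>The cevians from \<open>A\<close> and \<open>B\<close> both coincide with the side \<open>AB\<close>, which contains \<open>C'\<close>.\<close>
      then have "u = 1" by (simp add: D_def)
      have "C' \<in> line A A'" "C' \<in> line B B'"
        unfolding onA onB using 2 \<open>u = 1\<close>
        by (auto simp: C' BC intro: exI[of _ v] exI[of _ "1 - v"])
      then show ?thesis
        using endpoints_in_line(2)[of C' C] by (auto simp: concurrent_def)
    next
      case 3
      \<comment> \<open>The cevians from \<open>A\<close> and \<open>B\<close> are parallel, and Ceva's equation makes the
        direction from \<open>C\<close> a multiple of theirs.\<close>
      have "t * (1 - v * (1 - u)) = 0"
        using ceva 3(1) unfolding D_def by algebra
      then have v: "v * (1 - u) = 1" using 3 by simp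
      then have "v \<noteq> 0" by auto
      have t: "1 - t = - (t * v)"
        using 3(1) v unfolding D_def by algebra
      have uv: "1 - u = 1 / v"
        using v \<open>v \<noteq> 0\<close> by (simp add: field_simps)
      have "B' - B = (1 / (t * v)) *\<^sub>R (A' - A)"
        unfolding dA dB t uv using 3 \<open>v \<noteq> 0\<close> by (simp add: scaleR_diff_right)
      moreover have "C' - C = (- v) *\<^sub>R (B' - B)"
        unfolding dB dC uv using \<open>v \<noteq> 0\<close> by (simp add: scaleR_diff_right)
      ultimately have "affine_parallel (line A A') (line B B')" "affine_parallel (line B B') (line C C')"
        using 3 \<open>v \<noteq> 0\<close> scaled_direction_imp_parallel_lines by (metis divide_eq_0_iff mult_eq_0_iff neg_equal_0_iff_equal one_neq_zero)+
      then show ?thesis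
        by (simp add: concurrent_def)
    qed
  qed
qed

lemma vertex_not_on_opposite_side:
  assumes "proper_triangle A B C" and "H \<in> line B C"
  shows "A \<noteq> H"
proof
  assume "A = H"
  then have "collinear {B, C, A}"
    using assms(2) by (simp add: line_def affine_hull_3_imp_collinear)
  then show False
    using assms(1) by (simp add: proper_triangle_def insert_commute)
qed

section \<open>Isogonal lines and the two feet on the sides of an angle\<close>

text \<open>The ratio is the same datum seen from both ends of the side, which is what lets the relations
  at different vertices be multiplied together.\<close>

lemma foot_ratio:
  assumes "orth_projection P (line X Y) H"
  obtains t where "H = X + t *\<^sub>R (Y - X)"
    and "(P - X) \<bullet> (Y - X) = t * (norm (Y - X))\<^sup>2"
    and "(P - Y) \<bullet> (X - Y) = (1 - t) * (norm (Y - X))\<^sup>2"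
proof -
  obtain t where H: "H = X + t *\<^sub>R (Y - X)"
    using assms by (auto simp: orth_projection_def mem_line_iff)
  have "(P - H) \<bullet> (Y - X) = 0"
    using assms endpoints_in_line by (auto simp: orth_projection_def orthogonal_def)
  then have 1: "(P - X) \<bullet> (Y - X) = t * (norm (Y - X))\<^sup>2"
    by (simp add: H power2_norm_eq_inner inner_diff_left inner_add_left algebra_simps)
  have "(P - Y) \<bullet> (X - Y) = (norm (Y - X))\<^sup>2 - (P - X) \<bullet> (Y - X)"
    by (simp add: power2_norm_eq_inner inner_diff_left inner_diff_right inner_commute)
  then show ?thesis
    using that[OF H 1] 1 by (simp add: left_diff_distrib)
qed

text \<open>The reflection in the bisector exchanges the unit vectors \<open>e\<close>, \<open>f\<close> of the two sides
  and preserves inner products.  With \<open>x\<close>, \<open>y\<close> the vectors to a point and its mirror image, this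
  follows from \<open>x + y\<close> being parallel to \<open>e + f\<close>, hence orthogonal to \<open>e - f\<close>, and from
  \<open>x - y\<close> being orthogonal to \<open>e + f\<close>.\<close>

lemma mirror_swaps_sides:
  assumes "Y \<in> mirror_line (angle_bisector B A C) l" and "B \<noteq> A" and "C \<noteq> A"
  obtains X where "X \<in> l"
    and "(X - A) \<bullet> sgn (B - A) = (Y - A) \<bullet> sgn (C - A)"
    and "(X - A) \<bullet> sgn (C - A) = (Y - A) \<bullet> sgn (B - A)"
proof -
  define e f where "e = sgn (B - A)" and "f = sgn (C - A)"
  have unit: "e \<bullet> e = 1" "f \<bullet> f = 1"
    using assms(2,3) by (simp_all add: e_def f_def norm_sgn flip: power2_norm_eq_inner)
  obtain X where X: "X \<in> l" and pr: "orth_projection X (line A (A + e + f)) (midpoint X Y)"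
    using assms(1) by (auto simp: mirror_line_def angle_bisector_def e_def f_def)
  define x y where "x = X - A" and "y = Y - A"
  obtain k where "midpoint X Y = A + k *\<^sub>R (e + f)"
    using pr by (auto simp: orth_projection_def mem_line_iff)
  then have "2 *\<^sub>R midpoint X Y = 2 *\<^sub>R (A + k *\<^sub>R (e + f))"
    by simp
  then have sum: "x + y = (2 * k) *\<^sub>R (e + f)"
    by (simp add: midpoint_def x_def y_def algebra_simps scaleR_2)
  have "(X - midpoint X Y) \<bullet> (e + f) = 0"
  proof -
    have "orthogonal (X - midpoint X Y) ((A + e + f) - A)"
      using pr endpoints_in_line unfolding orth_projection_def by blast
    then show ?thesis
      by (simp add: orthogonal_def add.assoc)
  qed
  moreover have "X - midpoint X Y = (1 / 2) *\<^sub>R (x - y)"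
    by (simp add: midpoint_def x_def y_def algebra_simps flip: scaleR_add_left)
  ultimately have diff: "(x - y) \<bullet> (e + f) = 0"
    by simp
  have "(x + y) \<bullet> (e - f) = 0"
    unfolding sum using unit by (simp add: algebra_simps inner_commute)
  with diff have "x \<bullet> e = y \<bullet> f" "x \<bullet> f = y \<bullet> e"
    by (simp_all add: inner_diff_left inner_diff_right inner_add_left inner_add_right)
  with X that show ?thesis
    by (simp add: x_def y_def e_def f_def)
qed

text \<open>Up to scalars, the vectors to \<open>P\<close> and \<open>P'\<close> are a vector and its mirror image, so
  passing from one side of the angle to the other merely exchanges the two factors.\<close>

lemma isogonal_projection_products:
  assumes "isogonal_cevians A B C l m" and "P \<in> l" and "P' \<in> m"
    and "B \<noteq> A" and "C \<noteq> A"
  shows "((P - A) \<bullet> sgn (B - A)) * ((P' - A) \<bullet> sgn (B - A))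
       = ((P - A) \<bullet> sgn (C - A)) * ((P' - A) \<bullet> sgn (C - A))"
proof -
  obtain W where l: "l = line A W"
    using assms(1) by (auto simp: isogonal_cevians_def cevian_def)
  obtain X where X: "X \<in> l"
    "(X - A) \<bullet> sgn (B - A) = (P' - A) \<bullet> sgn (C - A)"
    "(X - A) \<bullet> sgn (C - A) = (P' - A) \<bullet> sgn (B - A)"
    using assms mirror_swaps_sides by (metis isogonal_cevians_def)
  obtain i j where "P - A = i *\<^sub>R (W - A)" "X - A = j *\<^sub>R (W - A)"
    using X(1) assms(2) unfolding l mem_line_iff by (metis add_diff_cancel_left')
  then show ?thesis
    by (simp flip: X(2,3))
qed

lemma isogonal_feet_products:
  assumes "isogonal_cevians A B C l m" and "P \<in> l" and "P' \<in> m"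
    and "B \<noteq> A" and "C \<noteq> A"
    and "(P - A) \<bullet> (B - A) = x * (norm (B - A))\<^sup>2"
    and "(P' - A) \<bullet> (B - A) = x' * (norm (B - A))\<^sup>2"
    and "(P - A) \<bullet> (C - A) = y * (norm (C - A))\<^sup>2"
    and "(P' - A) \<bullet> (C - A) = y' * (norm (C - A))\<^sup>2"
  shows "x * x' * (norm (B - A))\<^sup>2 = y * y' * (norm (C - A))\<^sup>2"
proof -
  have *: "Z \<bullet> sgn V = z * norm V" if "Z \<bullet> V = z * (norm V)\<^sup>2" for Z V :: point and z
    using that by (cases "V = 0") (simp_all add: sgn_div_norm power2_eq_square field_simps)
  show ?thesis
    using isogonal_projection_products[OF assms(1-5)]
    unfolding *[OF assms(6)] *[OF assms(7)] *[OF assms(8)] *[OF assms(9)]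
    by (simp add: power2_eq_square mult_ac)
qed

section \<open>Pedal triangles with a degenerate Ceva product\<close>

lemma circumcircle_rotate: "circumcircle A B C = circumcircle B C A"
  unfolding circumcircle_def by (rule Collect_cong) metis

text \<open>Right angles at \<open>A\<close> and \<open>B\<close> over the segment \<open>PC\<close> put \<open>A\<close> and \<open>B\<close> on Thales' circle with
  diameter \<open>PC\<close>, which is therefore the circumcircle.\<close>

lemma antipode_in_circumcircle:
  assumes "(P - A) \<bullet> (C - A) = 0" and "(P - B) \<bullet> (C - B) = 0"
  shows "P \<in> circumcircle A B C"
proof -
  define Q where "Q = midpoint P C"
  have thales: "dist Q X = dist Q C" if "(P - X) \<bullet> (C - X) = 0" for X
  proof -
    define p c where "p = P - X" and "c = C - X"
    have "2 *\<^sub>R (Q - X) = p + c" "2 *\<^sub>R (Q - C) = p - c"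
      by (simp_all add: p_def c_def Q_def midpoint_def scaleR_diff_right scaleR_2)
    moreover have "norm (p + c) = norm (p - c)"
      using that by (simp add: norm_eq_sqrt_inner p_def[symmetric] c_def[symmetric]
          inner_add_left inner_add_right inner_diff_left inner_diff_right inner_commute)
    ultimately have "norm (2 *\<^sub>R (Q - X)) = norm (2 *\<^sub>R (Q - C))"
      by simp
    then show ?thesis
      by (simp add: dist_norm)
  qed
  have "dist Q C = dist Q P"
    by (simp add: Q_def dist_midpoint)
  with thales[OF assms(1)] thales[OF assms(2)] show ?thesis
    unfolding circumcircle_def by (auto intro!: exI[of _ Q])
qed

text \<open>The vector \<open>q\<close> from \<open>A\<close> to the circumcenter is characterised by \<open>2 (q \<bullet> b) = b \<bullet> b\<close> and
  \<open>2 (q \<bullet> c) = c \<bullet> c\<close>, where \<open>b\<close>, \<open>c\<close> are the sides at \<open>A\<close>.  Cramer's rule solves this system, since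
  its Gram determinant vanishes only in the equality case of the Cauchy-Schwarz inequality.\<close>

lemma circumcenter_exists:
  assumes "proper_triangle A B C"
  shows "\<exists>Q. dist Q A = dist Q B \<and> dist Q A = dist Q C"
proof -
  define b c where "b = B - A" and "c = C - A"
  define G where "G = (b \<bullet> b) * (c \<bullet> c) - (b \<bullet> c)\<^sup>2"
  have "G \<noteq> 0"
  proof
    assume "G = 0"
    then have "(b \<bullet> c)\<^sup>2 = (norm b * norm c)\<^sup>2"
      by (simp add: G_def power_mult_distrib power2_norm_eq_inner)
    then have "\<bar>b \<bullet> c\<bar> = norm b * norm c"
      by (metis abs_ge_zero abs_mult abs_norm_cancel power2_eq_iff_nonneg power2_abs)
    then have "collinear {0, b, c}"
      by (simp add: norm_cauchy_schwarz_equal)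
    then show False
      using proper_triangle_sides_not_collinear[OF assms] by (simp add: b_def c_def)
  qed
  define x y where "x = ((b \<bullet> b) * (c \<bullet> c) - (c \<bullet> c) * (b \<bullet> c)) / (2 * G)"
    and "y = ((b \<bullet> b) * (c \<bullet> c) - (b \<bullet> b) * (b \<bullet> c)) / (2 * G)"
  define q where "q = x *\<^sub>R b + y *\<^sub>R c"
  have 2: "2 * G * x = (b \<bullet> b) * (c \<bullet> c) - (c \<bullet> c) * (b \<bullet> c)"
       "2 * G * y = (b \<bullet> b) * (c \<bullet> c) - (b \<bullet> b) * (b \<bullet> c)"
    using \<open>G \<noteq> 0\<close> by (simp_all add: x_def y_def)
  have "G * (2 * (q \<bullet> b)) = G * (b \<bullet> b)"
  proof -
    have "G * (2 * (q \<bullet> b)) = (2 * G * x) * (b \<bullet> b) + (2 * G * y) * (b \<bullet> c)"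
      by (simp add: q_def inner_add_left inner_commute algebra_simps)
    then show ?thesis
      unfolding 2 by (simp add: G_def power2_eq_square algebra_simps)
  qed
  then have qb: "2 * (q \<bullet> b) = b \<bullet> b"
    using \<open>G \<noteq> 0\<close> by simp
  have "G * (2 * (q \<bullet> c)) = G * (c \<bullet> c)"
  proof -
    have "G * (2 * (q \<bullet> c)) = (2 * G * x) * (b \<bullet> c) + (2 * G * y) * (c \<bullet> c)"
      by (simp add: q_def inner_add_left inner_commute algebra_simps)
    then show ?thesis
      unfolding 2 by (simp add: G_def power2_eq_square algebra_simps)
  qed
  then have qc: "2 * (q \<bullet> c) = c \<bullet> c"
    using \<open>G \<noteq> 0\<close> by simp
  have *: "norm q = norm (q - d)" if "2 * (q \<bullet> d) = d \<bullet> d" for d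
    using that by (simp add: norm_eq_sqrt_inner inner_diff_left inner_diff_right inner_commute)
  have "dist (A + q) A = dist (A + q) B" "dist (A + q) A = dist (A + q) C"
    using *[OF qb] *[OF qc] by (simp_all add: dist_norm b_def c_def algebra_simps)
  then show ?thesis by blast
qed

text \<open>A vector of the plane orthogonal to two independent sides is zero, so \<open>P\<close> is the
  vertex \<open>A\<close> itself; it belongs to \<open>circumcircle\<close> once a circumcenter is known to exist.\<close>

lemma vertex_in_circumcircle:
  assumes "proper_triangle A B C" and "(P - A) \<bullet> (B - A) = 0" and "(P - A) \<bullet> (C - A) = 0"
  shows "P \<in> circumcircle A B C"
proof -
  define w b c where "w = P - A" and "b = B - A" and "c = C - A"
  have "w $ 1 * b $ 1 + w $ 2 * b $ 2 = 0" "w $ 1 * c $ 1 + w $ 2 * c $ 2 = 0"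
    using assms(2,3) by (simp_all add: w_def b_def c_def inner_vec_def sum_2)
  moreover have "b $ 1 * c $ 2 - b $ 2 * c $ 1 \<noteq> 0"
  proof
    assume det: "b $ 1 * c $ 2 - b $ 2 * c $ 1 = 0"
    have "c $ 1 *\<^sub>R b + (- (b $ 1)) *\<^sub>R c = 0" "c $ 2 *\<^sub>R b + (- (b $ 2)) *\<^sub>R c = 0"
      using det by (simp_all add: vec_eq_iff forall_2 mult.commute)
    then have "- (b $ 1) = 0" "- (b $ 2) = 0"
      using proper_triangle_independent[OF assms(1)] unfolding b_def c_def by blast+
    then have "b = 0"
      by (simp add: vec_eq_iff forall_2)
    then show False
      using proper_triangle_sides_not_collinear[OF assms(1)] by (simp add: b_def)
  qed
  ultimately have "w $ 1 = 0" "w $ 2 = 0"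
    by algebra+
  then have "P = A"
    by (simp add: w_def vec_eq_iff forall_2)
  then show ?thesis
    using circumcenter_exists[OF assms(1)] by (auto simp: circumcircle_def)
qed

text \<open>If both Ceva products vanish, one of the ratios is 0 and a different one is 1.  Either
  the two feet coincide in a common endpoint of their sides, and \<open>P\<close> is that vertex, or they
  are the two ends of the third side, and \<open>P\<close> is the antipode of the opposite vertex.\<close>

lemma ceva_product_nonzero:
  assumes T: "proper_triangle A B C" and P: "P \<notin> circumcircle A B C"
    and t: "(P - B) \<bullet> (C - B) = t * (norm (C - B))\<^sup>2" "(P - C) \<bullet> (B - C) = (1 - t) * (norm (C - B))\<^sup>2"
    and u: "(P - C) \<bullet> (A - C) = u * (norm (A - C))\<^sup>2" "(P - A) \<bullet> (C - A) = (1 - u) * (norm (A - C))\<^sup>2"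
    and v: "(P - A) \<bullet> (B - A) = v * (norm (B - A))\<^sup>2" "(P - B) \<bullet> (A - B) = (1 - v) * (norm (B - A))\<^sup>2"
    and ceva: "t * u * v = (1 - t) * (1 - u) * (1 - v)"
  shows "t * u * v \<noteq> 0"
proof
  assume "t * u * v = 0"
  moreover from this ceva have "(1 - t) * (1 - u) * (1 - v) = 0" by simp
  ultimately consider "t = 0" "u = 1" | "t = 0" "v = 1" | "u = 0" "t = 1"
    | "u = 0" "v = 1" | "v = 0" "t = 1" | "v = 0" "u = 1"
    by fastforce
  then have "P \<in> circumcircle A B C"
  proof cases
    case 1
    then show ?thesis using antipode_in_circumcircle t u by simp
  next
    case 2
    then show ?thesis
      using vertex_in_circumcircle[of B C A P] T t v by (metis proper_triangle_rotate circumcircle_rotate diff_self mult_zero_left)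
  next
    case 3
    then show ?thesis
      using vertex_in_circumcircle[of C A B P] T t u by (metis proper_triangle_rotate circumcircle_rotate diff_self mult_zero_left)
  next
    case 4
    then show ?thesis
      using antipode_in_circumcircle[of P B A C] u v by (metis circumcircle_rotate diff_self mult_zero_left)
  next
    case 5
    then show ?thesis
      using antipode_in_circumcircle[of P C B A] t v by (metis circumcircle_rotate diff_self mult_zero_left)
  next
    case 6
    then show ?thesis
      using vertex_in_circumcircle[of A B C P] T u v by simp
  qed
  with P show False ..
qed

section \<open>Homology of pedal triangles under isogonal conjugation\<close>

theorem theorem7:
  fixes A B C P1 P2 A1 B1 C1 A2 B2 C2 :: point
  assumes "proper_triangle A B C"
    and "isogonal_points A B C P1 P2"
    and "pedal_triangle A B C P1 A1 B1 C1"
    and "pedal_triangle A B C P2 A2 B2 C2"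
    and "homological A B C A1 B1 C1"
  shows "homological A B C A2 B2 C2"
proof -
  note T = assms(1)
  have ne: "A \<noteq> B" "B \<noteq> C" "C \<noteq> A"
    using T by (auto simp: proper_triangle_def insert_commute)
  obtain lA lB lC mA mB mC where
    iso: "isogonal_cevians A B C lA mA" "isogonal_cevians B C A lB mB" "isogonal_cevians C A B lC mC"
    and P12: "lA \<inter> lB \<inter> lC = {P1}" "mA \<inter> mB \<inter> mC = {P2}"
    using assms(2) by (auto simp: isogonal_points_def)
  have on1: "P1 \<in> lA" "P1 \<in> lB" "P1 \<in> lC" and on2: "P2 \<in> mA" "P2 \<in> mB" "P2 \<in> mC"
    using P12 by auto
  have P1: "P1 \<notin> circumcircle A B C"
    and pr1: "orth_projection P1 (line B C) A1" "orth_projection P1 (line C A) B1"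
      "orth_projection P1 (line A B) C1"
    using assms(3) by (auto simp: pedal_triangle_def)
  have pr2: "orth_projection P2 (line B C) A2" "orth_projection P2 (line C A) B2"
      "orth_projection P2 (line A B) C2"
    using assms(4) by (auto simp: pedal_triangle_def)
  obtain t1 where t1: "A1 = B + t1 *\<^sub>R (C - B)" "(P1 - B) \<bullet> (C - B) = t1 * (norm (C - B))\<^sup>2"
      "(P1 - C) \<bullet> (B - C) = (1 - t1) * (norm (C - B))\<^sup>2"
    by (rule foot_ratio[OF pr1(1)])
  obtain u1 where u1: "B1 = C + u1 *\<^sub>R (A - C)" "(P1 - C) \<bullet> (A - C) = u1 * (norm (A - C))\<^sup>2"
      "(P1 - A) \<bullet> (C - A) = (1 - u1) * (norm (A - C))\<^sup>2"
    by (rule foot_ratio[OF pr1(2)])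
  obtain v1 where v1: "C1 = A + v1 *\<^sub>R (B - A)" "(P1 - A) \<bullet> (B - A) = v1 * (norm (B - A))\<^sup>2"
      "(P1 - B) \<bullet> (A - B) = (1 - v1) * (norm (B - A))\<^sup>2"
    by (rule foot_ratio[OF pr1(3)])
  obtain t2 where t2: "A2 = B + t2 *\<^sub>R (C - B)" "(P2 - B) \<bullet> (C - B) = t2 * (norm (C - B))\<^sup>2"
      "(P2 - C) \<bullet> (B - C) = (1 - t2) * (norm (C - B))\<^sup>2"
    by (rule foot_ratio[OF pr2(1)])
  obtain u2 where u2: "B2 = C + u2 *\<^sub>R (A - C)" "(P2 - C) \<bullet> (A - C) = u2 * (norm (A - C))\<^sup>2"
      "(P2 - A) \<bullet> (C - A) = (1 - u2) * (norm (A - C))\<^sup>2"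
    by (rule foot_ratio[OF pr2(2)])
  obtain v2 where v2: "C2 = A + v2 *\<^sub>R (B - A)" "(P2 - A) \<bullet> (B - A) = v2 * (norm (B - A))\<^sup>2"
      "(P2 - B) \<bullet> (A - B) = (1 - v2) * (norm (B - A))\<^sup>2"
    by (rule foot_ratio[OF pr2(3)])
  have ceva1: "t1 * u1 * v1 = (1 - t1) * (1 - u1) * (1 - v1)"
    using assms(5) ceva_iff_concurrent[OF T t1(1) u1(1) v1(1)] by (simp add: homological_def)
  have nz: "t1 * u1 * v1 \<noteq> 0"
    by (rule ceva_product_nonzero[OF T P1 t1(2,3) u1(2,3) v1(2,3) ceva1])
  define a b c where "a = (norm (C - B))\<^sup>2" and "b = (norm (A - C))\<^sup>2" and "c = (norm (B - A))\<^sup>2"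
  have abc: "a * b * c \<noteq> 0"
    using ne by (simp add: a_def b_def c_def)
  have "v1 * v2 * c = (1 - u1) * (1 - u2) * b"
    unfolding b_def c_def
    using isogonal_feet_products[OF iso(1) on1(1) on2(1), of v1 v2 "1 - u1" "1 - u2"] ne u1 u2 v1 v2
    by (simp add: norm_minus_commute)
  moreover have "t1 * t2 * a = (1 - v1) * (1 - v2) * c"
    unfolding a_def c_def
    using isogonal_feet_products[OF iso(2) on1(2) on2(2), of t1 t2 "1 - v1" "1 - v2"] ne t1 t2 v1 v2
    by (simp add: norm_minus_commute)
  moreover have "u1 * u2 * b = (1 - t1) * (1 - t2) * a"
    unfolding a_def b_def
    using isogonal_feet_products[OF iso(3) on1(3) on2(3), of u1 u2 "1 - t1" "1 - t2"] ne t1 t2 u1 u2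
    by (simp add: norm_minus_commute)
  ultimately have "(v1 * v2 * c) * (t1 * t2 * a) * (u1 * u2 * b)
      = ((1 - u1) * (1 - u2) * b) * ((1 - v1) * (1 - v2) * c) * ((1 - t1) * (1 - t2) * a)"
    by simp
  then have "(a * b * c) * ((t1 * u1 * v1) * (t2 * u2 * v2))
      = (a * b * c) * (((1 - t1) * (1 - u1) * (1 - v1)) * ((1 - t2) * (1 - u2) * (1 - v2)))"
    by (simp only: mult_ac)
  then have "t2 * u2 * v2 = (1 - t2) * (1 - u2) * (1 - v2)"
    using abc nz by (simp flip: ceva1)
  then have "concurrent (line A A2) (line B B2) (line C C2)"
    using ceva_iff_concurrent[OF T t2(1) u2(1) v2(1)] by simp
  moreover have "A \<noteq> A2" "B \<noteq> B2" "C \<noteq> C2"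
    using pr2 T vertex_not_on_opposite_side proper_triangle_rotate
    by (metis orth_projection_def)+
  ultimately show ?thesis
    by (simp add: homological_def)
qed

end
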